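(* Let $(\mathcal{X},d)$ be a favorable metric space and let $n>0$, $t\ge0$ be integers with $2t<n$. Then there exists a mapping $\widehat\mu_{n,t}:\mathcal{X}^n\to\mathcal{X}$, measurable with respect to the product $\sigma$-field of the Borel $\sigma$-fields on $\mathcal{X}^n$ and the Borel $\sigma$-field on $\mathcal{X}$, such that for all $(x_1,\dots,x_n)\in\mathcal{X}^n$, $$\widehat\mu_{n,t}(x_1,\dots,x_n)\in\mathop{\rm argmin}_{b\in\mathcal{X}}\sup_{a\in\mathcal{X}}T_{n,t}\big(d^2(b,\cdot)-d^2(a,\cdot)\big)(x_1,\dots,x_n).$$
   Context: **Favorable space.** A metric space $(\mathcal{X},d)$ is favorable if it is Polish and for each closed ball $B[o,R]=\{x\in\mathcal{X}:d(o,x)\le R\}$ ($o\in\mathcal{X}$, $R>0$) there is a topology $\mathcal{T}_{o,R}$ on $B[o,R]$ such that $(B[o,R],\mathcal{T}_{o,R})$ is compact and, for every $x\in\mathcal{X}$ and $u\in\mathbb{R}$, $\{y\in B[o,R]:d(x,y)>u\}\in\mathcal{T}_{o,R}$. **Trimmed mean.** For $f:\mathcal{X}\to\mathbb{R}$ and $x_1,\dots,x_n\in\mathcal{X}$, $T_{n,t}(f)(x_1,\dots,x_n):=\frac1{n-2t}\sum_{j=t+1}^{n-t}a_{(j)}$, where $a_{(1)}\le\dots\le a_{(n)}$ is the nondecreasing rearrangement of $(f(x_i))_{i=1}^n$. *)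

theory Defs
  imports "HOL-Analysis.Analysis"
begin

text \<open>
  The metric space is the whole type, with \<^term>\<open>dist\<close> as its metric. \<^emph>\<open>Polish\<close> means separable and
  completely metrizable: separability is the sort constraint \<^class>\<open>second_countable_topology\<close>
  (equivalent for metric spaces). The metric \<^term>\<open>dist\<close> itself is not required to be complete.
\<close>

definition favorable :: "'a::{metric_space, second_countable_topology} itself \<Rightarrow> bool" where
  "favorable (_ :: 'a itself) \<longleftrightarrow>
     completely_metrizable_space (euclidean :: 'a topology) \<and>
     (\<forall>(c::'a) (R::real). R > 0 \<longrightarrow>
        (\<exists>T :: 'a topology. topspace T = cball c R \<and> compact_space T \<and>
           (\<forall>(x::'a) (u::real). openin T {y \<in> cball c R. dist x y > u})))"

text \<open>
  Points and order statistics are indexed from \<open>0\<close>: the sample is \<open>x 0, \<dots>, x (n - 1)\<close>, and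
  \<open>a\<^sub>(\<^sub>j\<^sub>)\<close> is entry \<open>j - 1\<close> of the sorted list.
\<close>

definition trimmed_mean :: "nat \<Rightarrow> nat \<Rightarrow> ('a \<Rightarrow> real) \<Rightarrow> (nat \<Rightarrow> 'a) \<Rightarrow> real" where
  "trimmed_mean n t f x =
     1 / (real n - 2 * real t) * (\<Sum>j = t..<n - t. sort (map (\<lambda>i. f (x i)) [0..<n]) ! j)"

end

theory Submission
  imports Defs
begin

text \<open>
  Write \<open>F x b\<close> for the objective, the supremum over \<open>a\<close> of the trimmed means of
  \<open>d\<^sup>2(b, \<cdot>) - d\<^sup>2(a, \<cdot>)\<close>, and \<open>A x\<close> for its set of minimizers.

  The property of the trimmed mean that drives the proof is that it is monotone in the data and shifts by \<open>e\<close> when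
  all data shift by \<open>e\<close> (\<open>trimmed_mean_le_shift\<close>). Each \<open>d\<^sup>2(b, x i)\<close> is lower semicontinuous in \<open>b\<close>
  for the compact topologies that a favorable space puts on its closed balls, and a monotone
  shift-equivariant function of finitely many lower semicontinuous functions is lower
  semicontinuous; so \<open>F x\<close> is lower semicontinuous on each ball (\<open>objective_lsc\<close>). Together with
  coercivity (\<open>objective_coercive\<close>) this gives minimizers, and more: \<open>F x\<close> attains its minimum on
  every nonempty intersection \<open>C\<close> of closed balls. Hence \<open>A x\<close> meets \<open>C\<close> exactly when
  \<open>inf\<^sub>C F x \<le> inf F x\<close>.

  For the metric topology the same property of the trimmed mean makes the trimmed means continuous
  in \<open>b\<close>, uniformly in the competitor \<open>a\<close>, and continuous in \<open>a\<close>. Infima and suprema may therefore be taken over countable dense sets, so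
  both sides of that inequality are measurable in \<open>x\<close> (\<open>measurable_INF_objective\<close>).

  The selection follows a sequence of closed balls of radii \<open>1, 1/2, 1/4, \<dots>\<close> centred in a countable
  dense set, each step taking the first centre for which \<open>A x\<close> still meets all balls chosen so far.
  Every choice is measurable by the criterion above. The sets \<open>A x \<inter> C\<close> are closed in the compact
  topology of the first ball, so the nested sequence has a common point, which is the limit of the
  centres (\<open>measurable_selection_cells\<close>).
\<close>

section \<open>Order statistics and the trimmed mean\<close>

text \<open>
  Sublevel sets of order statistics become counting conditions, in which the sorting permutation no
  longer occurs. Both the monotonicity and the measurability of order statistics rest on this.
\<close>

lemma sort_nth_le_iff:
  fixes xs :: "'b::linorder list"
  assumes "j < length xs"
  shows "sort xs ! j \<le> v \<longleftrightarrow> j < length (filter (\<lambda>y. y \<le> v) xs)"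
proof -
  define ys where "ys = sort xs"
  have ys: "sorted ys" "j < length ys" using assms by (auto simp: ys_def)
  have "mset (filter (\<lambda>y. y \<le> v) ys) = mset (filter (\<lambda>y. y \<le> v) xs)"
    by (simp add: ys_def)
  then have "length (filter (\<lambda>y. y \<le> v) xs) = length (filter (\<lambda>y. y \<le> v) ys)"
    by (metis size_mset)
  also have "\<dots> = card {i. i < length ys \<and> ys ! i \<le> v}"
    by (rule length_filter_conv_card)
  finally have count: "length (filter (\<lambda>y. y \<le> v) xs) = card {i. i < length ys \<and> ys ! i \<le> v}" .
  show ?thesis
  proof (cases "ys ! j \<le> v")
    case True
    have "{..j} \<subseteq> {i. i < length ys \<and> ys ! i \<le> v}"
      using ys True by (auto intro: order_trans[OF sorted_nth_mono])
    from card_mono[OF _ this] show ?thesis using True count by (simp add: ys_def)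
  next
    case False
    have "{i. i < length ys \<and> ys ! i \<le> v} \<subseteq> {..<j}"
    proof clarify
      fix i assume "i < length ys" "ys ! i \<le> v"
      then show "i < j"
        using sorted_nth_mono[OF ys(1), of j i] False by (meson leI order_trans)
    qed
    from card_mono[OF _ this] show ?thesis using False count by (simp add: ys_def)
  qed
qed

text \<open>
  Monotonicity and shift equivariance in one inequality. With \<open>e\<close> small, this replaces every
  continuity argument about the trimmed mean below.
\<close>

lemma trimmed_mean_le_shift:
  assumes "2 * t < n" and le: "\<And>i. i < n \<Longrightarrow> f (x i) \<le> g (y i) + e"
  shows "trimmed_mean n t f x \<le> trimmed_mean n t g y + e"
proof -
  define p where "p = sort (map (\<lambda>i. f (x i)) [0..<n])"
  define q where "q = sort (map (\<lambda>i. g (y i)) [0..<n])"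
  have nth: "p ! j \<le> q ! j + e" if "j < n" for j
  proof -
    have "j < length (filter (\<lambda>z. z \<le> q ! j) (map (\<lambda>i. g (y i)) [0..<n]))"
      using that sort_nth_le_iff[of j "map (\<lambda>i. g (y i)) [0..<n]" "q ! j"] by (simp add: q_def)
    also have "\<dots> \<le> length (filter (\<lambda>z. z \<le> q ! j + e) (map (\<lambda>i. f (x i)) [0..<n]))"
      unfolding length_filter_conv_card using le by (intro card_mono) force+
    finally show ?thesis
      using that sort_nth_le_iff[of j "map (\<lambda>i. f (x i)) [0..<n]"] by (simp add: p_def)
  qed
  have pos: "real n - 2 * real t > 0" using assms(1) by linarith
  have "(\<Sum>j = t..<n - t. p ! j) \<le> (\<Sum>j = t..<n - t. q ! j + e)"
    by (intro sum_mono nth) auto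
  also have "\<dots> = (\<Sum>j = t..<n - t. q ! j) + (real n - 2 * real t) * e"
    using assms(1) by (simp add: sum.distrib of_nat_diff)
  finally have "(\<Sum>j = t..<n - t. p ! j) / (real n - 2 * real t)
      \<le> ((\<Sum>j = t..<n - t. q ! j) + (real n - 2 * real t) * e) / (real n - 2 * real t)"
    using pos by (intro divide_right_mono) auto
  then show ?thesis
    unfolding trimmed_mean_def p_def[symmetric] q_def[symmetric]
    using pos by (simp add: add_divide_distrib)
qed

lemma trimmed_mean_const:
  assumes "2 * t < n"
  shows "trimmed_mean n t (\<lambda>_. c) x = c"
proof -
  have pos: "real n - 2 * real t > 0" using assms by linarith
  have "sort (map (\<lambda>i. c) [0..<n]) = map (\<lambda>i. c) [0..<n]"
    by (simp add: map_replicate_const)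
  then have "(\<Sum>j = t..<n - t. sort (map (\<lambda>i. c) [0..<n]) ! j) = (\<Sum>j = t..<n - t. c)"
    by (intro sum.cong) auto
  also have "\<dots> = (real n - 2 * real t) * c"
    using assms by (simp add: of_nat_diff)
  finally have "(\<Sum>j = t..<n - t. sort (map (\<lambda>i. c) [0..<n]) ! j) = (real n - 2 * real t) * c" .
  then show ?thesis using pos by (simp add: trimmed_mean_def)
qed

lemma measurable_trimmed_mean:
  assumes f: "f \<in> borel_measurable N" and X: "\<And>i. i < n \<Longrightarrow> X i \<in> measurable M N"
  shows "(\<lambda>w. trimmed_mean n t f (\<lambda>i. X i w)) \<in> borel_measurable M"
proof -
  have fX: "(\<lambda>w. f (X i w)) \<in> borel_measurable M" if "i < n" for i
    using measurable_compose[OF X[OF that] f] .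
  have "(\<lambda>w. sort (map (\<lambda>i. f (X i w)) [0..<n]) ! j) \<in> borel_measurable M" if "j < n" for j
    unfolding borel_measurable_iff_le
  proof
    fix v
    define cnt where "cnt w = (\<Sum>i<n. indicator {w \<in> space M. f (X i w) \<le> v} w :: real)" for w
    have "cnt \<in> borel_measurable M"
      unfolding cnt_def
      by (intro borel_measurable_sum borel_measurable_indicator borel_measurable_le fX
            borel_measurable_const) auto
    then have "{w \<in> space M. real j < cnt w} \<in> sets M" by measurable
    moreover have "cnt w = real (length (filter (\<lambda>y. y \<le> v) (map (\<lambda>i. f (X i w)) [0..<n])))"
      if "w \<in> space M" for w
    proof -
      have "cnt w = (\<Sum>i<n. if f (X i w) \<le> v then 1 else 0)"
        unfolding cnt_def using that by (intro sum.cong) (auto simp: indicator_def)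
      also have "\<dots> = real (card ({..<n} \<inter> {i. f (X i w) \<le> v}))"
        by (simp add: sum.If_cases)
      also have "{..<n} \<inter> {i. f (X i w) \<le> v} =
          {i. i < length (map (\<lambda>i. f (X i w)) [0..<n]) \<and> map (\<lambda>i. f (X i w)) [0..<n] ! i \<le> v}"
        by auto
      finally show ?thesis by (simp only: length_filter_conv_card)
    qed
    ultimately show "{w \<in> space M. sort (map (\<lambda>i. f (X i w)) [0..<n]) ! j \<le> v} \<in> sets M"
      using that by (simp add: sort_nth_le_iff cong: conj_cong)
  qed
  then show ?thesis
    unfolding trimmed_mean_def by (intro borel_measurable_times borel_measurable_sum) auto
qed

section \<open>The objective function\<close>

definition objective :: "nat \<Rightarrow> nat \<Rightarrow> (nat \<Rightarrow> 'a::metric_space) \<Rightarrow> 'a \<Rightarrow> ereal" where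
  "objective n t x b = (SUP a. ereal (trimmed_mean n t (\<lambda>z. (dist b z)\<^sup>2 - (dist a z)\<^sup>2) x))"

text \<open>
  The approximation is uniform over the sample and does not involve the competitor \<open>a\<close>. For this
  reason it also controls the objective, a supremum over the whole space of competitors.
\<close>

lemma dist_sq_approx:
  fixes x :: "nat \<Rightarrow> 'a::metric_space"
  assumes "b \<in> closure D" and "e > 0"
  obtains d where "d \<in> D"
    and "\<And>i. i < n \<Longrightarrow> \<bar>(dist d (x i))\<^sup>2 - (dist b (x i))\<^sup>2\<bar> < e"
proof -
  have "\<forall>\<^sub>F d in nhds b. \<bar>(dist d (x i))\<^sup>2 - (dist b (x i))\<^sup>2\<bar> < e" for i
  proof -
    have "((\<lambda>d. (dist d (x i))\<^sup>2) \<longlongrightarrow> (dist b (x i))\<^sup>2) (nhds b)"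
      by (intro tendsto_intros) (simp add: filterlim_ident)
    from tendstoD[OF this \<open>e > 0\<close>] show ?thesis by (simp add: dist_real_def)
  qed
  then have "\<forall>\<^sub>F d in nhds b. \<forall>i\<in>{..<n}. \<bar>(dist d (x i))\<^sup>2 - (dist b (x i))\<^sup>2\<bar> < e"
    by (intro eventually_ball_finite) auto
  then obtain U where "open U" "b \<in> U"
    and U: "\<And>d. d \<in> U \<Longrightarrow> \<forall>i\<in>{..<n}. \<bar>(dist d (x i))\<^sup>2 - (dist b (x i))\<^sup>2\<bar> < e"
    unfolding eventually_nhds by blast
  then have "U \<inter> D \<noteq> {}"
    using assms(1) open_Int_closure_eq_empty[of U D] by auto
  then show thesis using U that by blast
qed

lemma objective_eq_SUP_dense:
  fixes x :: "nat \<Rightarrow> 'a::metric_space"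
  assumes "2 * t < n" and D: "closure D = UNIV"
  shows "objective n t x b =
    (SUP a\<in>D. ereal (trimmed_mean n t (\<lambda>z. (dist b z)\<^sup>2 - (dist a z)\<^sup>2) x))"
    (is "_ = (SUP a\<in>D. ereal (?m a))")
proof (rule antisym)
  show "objective n t x b \<le> (SUP a\<in>D. ereal (?m a))"
    unfolding objective_def
  proof (rule SUP_least, rule ereal_le_epsilon2)
    fix a and e :: real assume "e > 0"
    then obtain d where d: "d \<in> D" "\<And>i. i < n \<Longrightarrow> \<bar>(dist d (x i))\<^sup>2 - (dist a (x i))\<^sup>2\<bar> < e"
      using dist_sq_approx[of a D e n x] D by auto
    have "?m a \<le> ?m d + e"
      using d(2) by (intro trimmed_mean_le_shift assms) (smt (verit))
    then have "ereal (?m a) \<le> ereal (?m d) + ereal e" by simp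
    also have "\<dots> \<le> (SUP a\<in>D. ereal (?m a)) + ereal e"
      using d(1) by (intro add_right_mono SUP_upper)
    finally show "ereal (?m a) \<le> (SUP a\<in>D. ereal (?m a)) + ereal e" .
  qed
  show "(SUP a\<in>D. ereal (?m a)) \<le> objective n t x b"
    unfolding objective_def by (rule SUP_subset_mono) auto
qed

lemma INF_objective_eq_dense:
  fixes x :: "nat \<Rightarrow> 'a::metric_space"
  assumes "2 * t < n" and "D \<subseteq> C" "C \<subseteq> closure D"
  shows "(INF b\<in>C. objective n t x b) = (INF b\<in>D. objective n t x b)"
proof (rule antisym)
  show "(INF b\<in>C. objective n t x b) \<le> (INF b\<in>D. objective n t x b)"
    by (rule INF_superset_mono[OF assms(2)]) simp
  show "(INF b\<in>D. objective n t x b) \<le> (INF b\<in>C. objective n t x b)"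
  proof (rule INF_greatest, rule ereal_le_epsilon2)
    fix b and e :: real assume "b \<in> C" "e > 0"
    then obtain d where d: "d \<in> D" "\<And>i. i < n \<Longrightarrow> \<bar>(dist d (x i))\<^sup>2 - (dist b (x i))\<^sup>2\<bar> < e"
      using dist_sq_approx[of b D e n x] assms by blast
    have "(INF b\<in>D. objective n t x b) \<le> objective n t x d"
      using d(1) by (rule INF_lower)
    also have "\<dots> \<le> objective n t x b + ereal e"
      unfolding objective_def
    proof (rule SUP_least)
      fix a
      have "trimmed_mean n t (\<lambda>z. (dist d z)\<^sup>2 - (dist a z)\<^sup>2) x
          \<le> trimmed_mean n t (\<lambda>z. (dist b z)\<^sup>2 - (dist a z)\<^sup>2) x + e"
        using d(2) by (intro trimmed_mean_le_shift assms) (smt (verit))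
      then have "ereal (trimmed_mean n t (\<lambda>z. (dist d z)\<^sup>2 - (dist a z)\<^sup>2) x)
          \<le> ereal (trimmed_mean n t (\<lambda>z. (dist b z)\<^sup>2 - (dist a z)\<^sup>2) x) + ereal e" by simp
      also have "\<dots> \<le> (SUP a. ereal (trimmed_mean n t (\<lambda>z. (dist b z)\<^sup>2 - (dist a z)\<^sup>2) x)) + ereal e"
        by (intro add_right_mono SUP_upper) simp
      finally show "ereal (trimmed_mean n t (\<lambda>z. (dist d z)\<^sup>2 - (dist a z)\<^sup>2) x) \<le> \<dots>" .
    qed
    finally show "(INF b\<in>D. objective n t x b) \<le> objective n t x b + ereal e" .
  qed
qed

lemma countable_dense_subset:
  fixes C :: "'a::second_countable_topology set"
  obtains D where "countable D" "D \<subseteq> C" "C \<subseteq> closure D"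
proof -
  obtain B :: "'a set set" where B: "countable B" "topological_basis B"
    using ex_countable_basis by blast
  define D where "D = (\<lambda>U. SOME x. x \<in> U \<inter> C) ` {U \<in> B. U \<inter> C \<noteq> {}}"
  have pick: "(SOME x. x \<in> U \<inter> C) \<in> U \<inter> C" if "U \<inter> C \<noteq> {}" for U
    using that some_in_eq by blast
  show thesis
  proof
    show "countable D" unfolding D_def using B(1) by simp
    show "D \<subseteq> C" unfolding D_def using pick by blast
    show "C \<subseteq> closure D"
    proof
      fix c assume "c \<in> C"
      show "c \<in> closure D"
        unfolding closure_iff_nhds_not_empty
      proof safe
        fix A V assume "V \<subseteq> A" "open V" "c \<in> V" and empty: "D \<inter> A = {}"
        then obtain U where U: "U \<in> B" "c \<in> U" "U \<subseteq> V"
          using topological_basisE[OF B(2)] by metis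
        then have "U \<inter> C \<noteq> {}" using \<open>c \<in> C\<close> by blast
        then have "(SOME x. x \<in> U \<inter> C) \<in> D \<inter> A"
          using U \<open>V \<subseteq> A\<close> pick[of U] by (auto simp: D_def)
        then show False using empty by blast
      qed
    qed
  qed
qed

text \<open>
  Infima and suprema over uncountable index sets do not preserve measurability; countable dense
  subsets reduce both operations to countable ones.
\<close>

lemma measurable_INF_objective:
  fixes C :: "'a::{metric_space, second_countable_topology} set"
  assumes "2 * t < n"
  shows "(\<lambda>x. INF b\<in>C. objective n t x b) \<in> borel_measurable (\<Pi>\<^sub>M i\<in>{..<n}. (borel :: 'a measure))"
proof -
  obtain D :: "'a set" where D: "countable D" "UNIV \<subseteq> closure D"
    by (rule countable_dense_subset[of UNIV])
  obtain E where E: "countable E" "E \<subseteq> C" "C \<subseteq> closure E"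
    using countable_dense_subset[of C] by blast
  have "(\<lambda>x. INF b\<in>C. objective n t x b) = (\<lambda>x. INF b\<in>E. SUP a\<in>D.
      ereal (trimmed_mean n t (\<lambda>z. (dist b z)\<^sup>2 - (dist a z)\<^sup>2) (\<lambda>i. x i)))"
    unfolding INF_objective_eq_dense[OF assms E(2,3)]
    unfolding objective_eq_SUP_dense[OF assms top.extremum_uniqueI[OF D(2)]] ..
  also have "\<dots> \<in> borel_measurable (\<Pi>\<^sub>M i\<in>{..<n}. (borel :: 'a measure))"
  proof (rule borel_measurable_INF[OF E(1)], rule borel_measurable_SUP[OF D(1)],
      rule borel_measurable_ereal, rule measurable_trimmed_mean[where N = borel])
    show "(\<lambda>z. (dist b z)\<^sup>2 - (dist a z)\<^sup>2) \<in> borel_measurable borel" for a b :: 'a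
      by measurable
    show "(\<lambda>x. x i) \<in> measurable (\<Pi>\<^sub>M i\<in>{..<n}. (borel :: 'a measure)) borel" if "i < n" for i
      by (rule measurable_component_singleton) (use that in simp)
  qed
  finally show ?thesis .
qed

section \<open>Lower semicontinuity and compactness\<close>

definition compact_ball_topology :: "'a::metric_space \<Rightarrow> real \<Rightarrow> 'a topology \<Rightarrow> bool" where
  "compact_ball_topology c R T \<longleftrightarrow> topspace T = cball c R \<and> compact_space T \<and>
     (\<forall>x u. openin T {y \<in> cball c R. dist x y > u})"

lemma closedin_cball:
  assumes "compact_ball_topology c R T"
  shows "closedin T (cball c R \<inter> cball y r)"
proof -
  have "cball c R - (cball c R \<inter> cball y r) = {z \<in> cball c R. dist y z > r}" by auto
  then show ?thesis
    using assms unfolding closedin_def compact_ball_topology_def by auto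
qed

text \<open>
  A supremum of lower semicontinuous functions is lower semicontinuous, so a single competitor \<open>a\<close>
  can be treated. If the trimmed mean at \<open>b\<close> exceeds a level by \<open>e\<close>, then on the open set where each
  \<open>d\<^sup>2(\<cdot>, x i)\<close> exceeds its value at \<open>b\<close> minus \<open>e\<close> the trimmed mean drops by at most \<open>e\<close>.
\<close>

lemma objective_lsc:
  assumes T: "compact_ball_topology c R T" and "2 * t < n"
  shows "closedin T {b \<in> cball c R. objective n t x b \<le> s}"
proof -
  have top: "topspace T = cball c R"
    and gt: "openin T {y \<in> cball c R. dist z y > u}" for z u
    using T by (auto simp: compact_ball_topology_def)
  have "openin T {b \<in> cball c R. s < ereal (trimmed_mean n t (\<lambda>z. (dist b z)\<^sup>2 - (dist a z)\<^sup>2) x)}"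
    (is "openin T ?S") for a
  proof (subst openin_subopen, intro ballI)
    let ?m = "\<lambda>b. trimmed_mean n t (\<lambda>z. (dist b z)\<^sup>2 - (dist a z)\<^sup>2) x"
    fix b assume b: "b \<in> ?S"
    then obtain r where r: "s < ereal r" "r < ?m b"
      using ereal_dense2[of s "ereal (?m b)"] by auto
    \<comment> \<open>\<open>s\<close> may be infinite; the real level \<open>r\<close> between \<open>s\<close> and the value at \<open>b\<close> makes \<open>e\<close> finite.\<close>
    define e where "e = ?m b - r"
    have "e > 0" using r by (simp add: e_def)
    define W where "W i = {y \<in> cball c R. (dist b (x i))\<^sup>2 - e < (dist y (x i))\<^sup>2}" for i
    have "openin T (W i)" for i
    proof (cases "(dist b (x i))\<^sup>2 - e < 0")
      case True
      then have "W i = topspace T" unfolding W_def top by (force intro: less_le_trans[OF _ zero_le_power2])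
      then show ?thesis by simp
    next
      case False
      then have "W i = {y \<in> cball c R. dist (x i) y > sqrt ((dist b (x i))\<^sup>2 - e)}"
        unfolding W_def by (simp add: real_less_lsqrt real_sqrt_less_iff dist_commute
            flip: real_sqrt_less_iff[of "(dist b (x i))\<^sup>2 - e"])
      then show ?thesis using gt by simp
    qed
    then have "openin T ((\<Inter>i\<in>{..<n}. W i) \<inter> topspace T)"
      by (intro openin_INT) auto
    moreover have "b \<in> (\<Inter>i\<in>{..<n}. W i) \<inter> topspace T"
      using b \<open>e > 0\<close> by (auto simp: W_def top)
    moreover have "(\<Inter>i\<in>{..<n}. W i) \<inter> topspace T \<subseteq> ?S"
    proof
      fix y assume y: "y \<in> (\<Inter>i\<in>{..<n}. W i) \<inter> topspace T"
      have "?m b \<le> ?m y + e"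
        using y by (intro trimmed_mean_le_shift assms) (force simp: W_def)
      then have "r \<le> ?m y" by (simp add: e_def)
      then have "s < ereal (?m y)" using r(1) by (meson ereal_less_eq(3) less_le_trans)
      then show "y \<in> ?S" using y by (simp add: top)
    qed
    ultimately show "\<exists>U. openin T U \<and> b \<in> U \<and> U \<subseteq> ?S" by blast
  qed
  then have "openin T (\<Union>a. {b \<in> cball c R.
      s < ereal (trimmed_mean n t (\<lambda>z. (dist b z)\<^sup>2 - (dist a z)\<^sup>2) x)})" by blast
  also have "(\<Union>a. {b \<in> cball c R. s < ereal (trimmed_mean n t (\<lambda>z. (dist b z)\<^sup>2 - (dist a z)\<^sup>2) x)})
      = topspace T - {b \<in> cball c R. objective n t x b \<le> s}"
    unfolding top objective_def SUP_le_iff by (simp add: set_eq_iff not_le[symmetric] del: not_le) blast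
  finally show ?thesis unfolding closedin_def top by auto
qed

text \<open>
  The sublevel sets \<open>{b \<in> K. F b \<le> F a}\<close> for \<open>a \<in> K\<close> are nested closed sets, each containing its \<open>a\<close>;
  by compactness they have a common point.
\<close>

lemma compact_lsc_attains_min:
  fixes F :: "'b \<Rightarrow> 'c::linorder"
  assumes T: "compact_space T" and lsc: "\<And>s. closedin T {b \<in> topspace T. F b \<le> s}"
    and K: "closedin T K" "K \<noteq> {}"
  shows "\<exists>b\<in>K. \<forall>a\<in>K. F b \<le> F a"
proof -
  define L where "L a = K \<inter> {b \<in> topspace T. F b \<le> F a}" for a
  have "\<Inter>(L ` K) \<noteq> {}"
  proof (rule compact_space_fip[THEN iffD1, rule_format, OF T], intro conjI ballI allI impI)
    show "closedin T C" if "C \<in> L ` K" for C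
      using that K(1) lsc by (auto simp: L_def)
    fix \<F> assume "finite \<F> \<and> \<F> \<subseteq> L ` K"
    then obtain J where J: "finite J" "J \<subseteq> K" "\<F> = L ` J"
      by (meson finite_subset_image)
    show "\<Inter>\<F> \<noteq> {}"
    proof (cases "J = {}")
      case False
      then have "arg_min_on F J \<in> \<Inter>\<F>"
        using J arg_min_if_finite(1)[of J F] arg_min_least[of J _ F] closedin_subset[OF K(1)]
        by (auto simp: L_def)
      then show ?thesis by blast
    qed (use J in auto)
  qed
  then obtain b where "b \<in> \<Inter>(L ` K)" by blast
  then have "b \<in> L a" if "a \<in> K" for a using that by blast
  then show ?thesis using K(2) by (auto simp: L_def)
qed

lemma objective_attains_min_on_closed:
  assumes T: "compact_ball_topology c R T" and "2 * t < n" and "closedin T K" "K \<noteq> {}"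
  shows "\<exists>b\<in>K. \<forall>a\<in>K. objective n t x b \<le> objective n t x a"
  using assms objective_lsc[OF T assms(2)]
  by (intro compact_lsc_attains_min[of T]) (auto simp: compact_ball_topology_def)

definition minimizers :: "nat \<Rightarrow> nat \<Rightarrow> (nat \<Rightarrow> 'a::metric_space) \<Rightarrow> 'a set" where
  "minimizers n t x = {b. \<forall>a. objective n t x b \<le> objective n t x a}"

lemma closedin_minimizers:
  assumes "compact_ball_topology c R T" and "2 * t < n"
  shows "closedin T (cball c R \<inter> minimizers n t x)"
proof -
  have "cball c R \<inter> minimizers n t x = (\<Inter>a. {b \<in> cball c R. objective n t x b \<le> objective n t x a})"
    by (auto simp: minimizers_def)
  then show ?thesis using objective_lsc[OF assms] by auto
qed

text \<open>
  Points far from the sample lose to the single competitor \<open>o'\<close>, while \<open>o'\<close> itself is never beaten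
  by more than \<open>D\<^sup>2\<close>. Minimizing over one closed ball is therefore enough.
\<close>

lemma objective_coercive:
  assumes "2 * t < n" and D: "\<And>i. i < n \<Longrightarrow> dist o' (x i) \<le> D" and "D \<ge> 0"
    and b: "dist o' b > 3 * D + 1"
  shows "objective n t x o' \<le> ereal (D\<^sup>2)" and "ereal (D\<^sup>2) < objective n t x b"
proof -
  have sq: "(dist o' (x i))\<^sup>2 \<le> D\<^sup>2" if "i < n" for i
    using D[OF that] by (intro power_mono) auto
  show "objective n t x o' \<le> ereal (D\<^sup>2)"
    unfolding objective_def
  proof (rule SUP_least)
    fix a
    have "trimmed_mean n t (\<lambda>z. (dist o' z)\<^sup>2 - (dist a z)\<^sup>2) x \<le> trimmed_mean n t (\<lambda>_. D\<^sup>2) x + 0"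
      using sq by (intro trimmed_mean_le_shift assms) (smt (verit) zero_le_power2)
    then show "ereal (trimmed_mean n t (\<lambda>z. (dist o' z)\<^sup>2 - (dist a z)\<^sup>2) x) \<le> ereal (D\<^sup>2)"
      by (simp add: trimmed_mean_const assms)
  qed
  have "D\<^sup>2 + 1 + (dist o' (x i))\<^sup>2 \<le> (dist b (x i))\<^sup>2" if "i < n" for i
  proof -
    have "2 * D + 1 \<le> dist b (x i)"
      using D[OF that] b dist_triangle[of o' b "x i"] by (simp add: dist_commute)
    then have "(2 * D + 1)\<^sup>2 \<le> (dist b (x i))\<^sup>2"
      using \<open>D \<ge> 0\<close> by (intro power_mono) auto
    moreover have "D\<^sup>2 + 1 + D\<^sup>2 \<le> (2 * D + 1)\<^sup>2"
      using \<open>D \<ge> 0\<close> by (simp add: power2_eq_square algebra_simps)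
    ultimately show ?thesis using sq[OF that] by linarith
  qed
  then have "trimmed_mean n t (\<lambda>_. D\<^sup>2 + 1) x
      \<le> trimmed_mean n t (\<lambda>z. (dist b z)\<^sup>2 - (dist o' z)\<^sup>2) x + 0"
    by (intro trimmed_mean_le_shift assms) (smt (verit))
  then have "ereal (D\<^sup>2) < ereal (trimmed_mean n t (\<lambda>z. (dist b z)\<^sup>2 - (dist o' z)\<^sup>2) x)"
    by (simp add: trimmed_mean_const assms)
  also have "\<dots> \<le> objective n t x b"
    unfolding objective_def by (rule SUP_upper) simp
  finally show "ereal (D\<^sup>2) < objective n t x b" .
qed

lemma minimizers_nonempty:
  fixes x :: "nat \<Rightarrow> 'a::metric_space"
  assumes balls: "\<forall>(c::'a) R. R > 0 \<longrightarrow> (\<exists>T. compact_ball_topology c R T)" and "2 * t < n"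
  shows "minimizers n t x \<noteq> {}"
proof -
  \<comment> \<open>Any bound on the distances from \<open>x 0\<close> to the sample would do; the sum avoids a maximum.\<close>
  define D where "D = (\<Sum>i<n. dist (x 0) (x i))"
  have D: "dist (x 0) (x i) \<le> D" if "i < n" for i
    unfolding D_def using that by (intro member_le_sum) auto
  have "D \<ge> 0" unfolding D_def by (intro sum_nonneg) auto
  then obtain T where T: "compact_ball_topology (x 0) (3 * D + 1) T"
    using balls[rule_format, of "3 * D + 1" "x 0"] by auto
  have "closedin T (cball (x 0) (3 * D + 1))"
    using T closedin_topspace[of T] by (simp add: compact_ball_topology_def)
  moreover have "cball (x 0) (3 * D + 1) \<noteq> {}" using \<open>D \<ge> 0\<close> by simp
  ultimately obtain b
    where "\<forall>a\<in>cball (x 0) (3 * D + 1). objective n t x b \<le> objective n t x a"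
    using objective_attains_min_on_closed[OF T assms(2)] by metis
  then have b: "objective n t x b \<le> objective n t x a" if "a \<in> cball (x 0) (3 * D + 1)" for a
    using that by blast
  have "objective n t x b \<le> objective n t x a" for a
  proof (cases "a \<in> cball (x 0) (3 * D + 1)")
    case False
    then have "dist (x 0) a > 3 * D + 1" by simp
    from objective_coercive[OF assms(2) D \<open>D \<ge> 0\<close> this]
    have "objective n t x (x 0) \<le> objective n t x a" by (meson less_imp_le order_trans)
    moreover have "objective n t x b \<le> objective n t x (x 0)"
      using \<open>D \<ge> 0\<close> by (intro b) simp
    ultimately show ?thesis by (rule order_trans[rotated])
  qed (rule b)
  then show ?thesis by (auto simp: minimizers_def)
qed

section \<open>Measurable selection along nested balls\<close>

text \<open>
  The radii halve with the position in the list, so the points of an infinite sequence of centres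
  whose cells remain nonempty converge.
\<close>

definition cell :: "'a::metric_space list \<Rightarrow> 'a set" where
  "cell s = (\<Inter>k<length s. cball (s ! k) ((1/2) ^ k))"

lemma cell_snoc: "cell (s @ [a]) = cell s \<inter> cball a ((1/2) ^ length s)"
  by (auto simp: cell_def nth_append lessThan_Suc)

text \<open>
  A measurable selection principle in the manner of Kuratowski and Ryll-Nardzewski. The hypothesis
  on nested cells plays the part that completeness and closed values have there: it puts a point of
  \<open>A w\<close> into all the balls, and by the shrinking radii this point is the limit of the centres.
\<close>

lemma measurable_selection_cells:
  fixes A :: "'b \<Rightarrow> 'a::{metric_space, second_countable_topology} set"
  assumes ne: "\<And>w. w \<in> space M \<Longrightarrow> A w \<noteq> {}"
    and meas: "\<And>s. {w \<in> space M. A w \<inter> cell s \<noteq> {}} \<in> sets M"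
    and fip: "\<And>w c. w \<in> space M \<Longrightarrow> (\<And>k. A w \<inter> cell (map c [0..<k]) \<noteq> {})
      \<Longrightarrow> A w \<inter> (\<Inter>k. cball (c k) ((1/2) ^ k)) \<noteq> {}"
  shows "\<exists>\<mu> \<in> borel_measurable M. \<forall>w \<in> space M. \<mu> w \<in> A w"
proof -
  obtain D :: "'a set" where D: "countable D" "UNIV \<subseteq> closure D"
    by (rule countable_dense_subset[of UNIV])
  define q where "q = from_nat_into D"
  have q: "\<exists>j. dist (q j) z \<le> e" if pos: "e > 0" for z e
  proof -
    have "z \<in> closure D" using D(2) by blast
    then obtain d where d: "d \<in> D" "dist d z < e"
      using pos unfolding closure_approachable by metis
    moreover obtain j where "q j = d"
      using from_nat_into_surj[OF D(1) d(1)] by (auto simp: q_def)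
    ultimately show ?thesis by (auto intro: less_imp_le)
  qed
  define N where "N w s = (LEAST j. A w \<inter> cell (map q (s @ [j])) \<noteq> {})" for w s
  define path where "path w = rec_nat [] (\<lambda>_ s. s @ [N w s])" for w
  have path: "path w 0 = []" "path w (Suc k) = path w k @ [N w (path w k)]" for w k
    by (simp_all add: path_def)
  have len: "length (path w k) = k" for w k by (induction k) (simp_all add: path)
  define c where "c w k = q (N w (path w k))" for w k
  have path_eq: "map q (path w k) = map (c w) [0..<k]" for w k
    by (induction k) (simp_all add: path c_def)
  have meets: "A w \<inter> cell (map q (path w k)) \<noteq> {}" if "w \<in> space M" for w k
  proof (induction k)
    case 0
    then show ?case using ne[OF that] by (simp add: path cell_def)
  next
    case (Suc k)
    then obtain z where z: "z \<in> A w" "z \<in> cell (map q (path w k))" by blast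
    obtain j where "dist (q j) z \<le> (1/2) ^ k" using q[of "(1/2) ^ k" z] by auto
    then have "A w \<inter> cell (map q (path w k @ [j])) \<noteq> {}"
      using z by (auto simp: cell_snoc len)
    then have "A w \<inter> cell (map q (path w k @ [N w (path w k)])) \<noteq> {}"
      unfolding N_def by (rule LeastI)
    then show ?case by (simp add: path)
  qed
  have "\<exists>z. z \<in> A w \<and> (\<forall>k. dist (c w k) z \<le> (1/2) ^ k)" if "w \<in> space M" for w
  proof -
    have "A w \<inter> (\<Inter>k. cball (c w k) ((1/2) ^ k)) \<noteq> {}"
      using fip[OF that, of "c w"] meets[OF that] unfolding path_eq by blast
    then show ?thesis by auto
  qed
  then obtain \<mu> where \<mu>: "\<And>w. w \<in> space M \<Longrightarrow> \<mu> w \<in> A w"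
    and lim: "\<And>w k. w \<in> space M \<Longrightarrow> dist (c w k) (\<mu> w) \<le> (1/2) ^ k"
    by metis
  have N_meas: "(\<lambda>w. N w s) \<in> measurable M (count_space UNIV)" for s
    unfolding N_def
    by (intro measurable_Least) (use meas in \<open>simp add: pred_def\<close>)
  have path_meas: "(\<lambda>w. path w k) \<in> measurable M (count_space UNIV)" for k
  proof (induction k)
    case (Suc k)
    have "(\<lambda>w. s @ [N w s]) \<in> measurable M (count_space UNIV)" for s
      using N_meas by (rule measurable_compose) simp
    from measurable_compose_countable[OF this Suc] show ?case by (simp add: path)
  qed (simp add: path)
  have "(\<lambda>w. c w k) \<in> borel_measurable M" for k
    unfolding c_def
    by (rule measurable_compose[OF measurable_compose_countable[OF N_meas path_meas]]) simp
  moreover have "(\<lambda>k. c w k) \<longlonglongrightarrow> \<mu> w" if "w \<in> space M" for w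
  proof (rule metric_tendsto_imp_tendsto)
    show "(\<lambda>k. (1/2::real) ^ k) \<longlonglongrightarrow> 0" by (rule LIMSEQ_power_zero) simp
    show "\<forall>\<^sub>F k in sequentially. dist (c w k) (\<mu> w) \<le> dist ((1/2::real) ^ k) 0"
      using lim[OF that] by simp
  qed
  ultimately have "\<mu> \<in> borel_measurable M" by (rule borel_measurable_LIMSEQ_metric)
  then show ?thesis using \<mu> by blast
qed

section \<open>Measurable minimizers\<close>

lemma closedin_cell:
  assumes T: "compact_ball_topology (s ! 0) 1 T" and "s \<noteq> []"
  shows "closedin T (cell s)"
proof -
  have "cell s = (\<Inter>k<length s. cball (s ! 0) 1 \<inter> cball (s ! k) ((1/2) ^ k))"
    using assms(2) by (force simp: cell_def)
  also have "closedin T \<dots>"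
    using assms(2) by (intro closedin_INT closedin_cball[OF T]) auto
  finally show ?thesis .
qed

text \<open>
  An inequality between two infima characterizes the existence of a point because the infimum over
  the cell is attained, the cell being closed in the compact topology of its first ball. The cell of the empty list is the whole space, where coercivity takes
  the place of compactness.
\<close>

lemma minimizers_meet_cell_iff:
  fixes x :: "nat \<Rightarrow> 'a::metric_space"
  assumes balls: "\<forall>(c::'a) R. R > 0 \<longrightarrow> (\<exists>T. compact_ball_topology c R T)" and "2 * t < n"
    and "cell s \<noteq> {}"
  shows "minimizers n t x \<inter> cell s \<noteq> {} \<longleftrightarrow>
    (INF b\<in>cell s. objective n t x b) \<le> (INF b. objective n t x b)"
proof (cases "s = []")
  case True
  then show ?thesis using minimizers_nonempty[OF balls assms(2)] by (simp add: cell_def)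
next
  case False
  obtain T where T: "compact_ball_topology (s ! 0) 1 T" using balls[rule_format, of 1] by auto
  obtain b where b: "b \<in> cell s" "\<And>a. a \<in> cell s \<Longrightarrow> objective n t x b \<le> objective n t x a"
    using objective_attains_min_on_closed[OF T assms(2) closedin_cell[OF T False] assms(3)] by blast
  have "(INF b\<in>cell s. objective n t x b) = objective n t x b"
    using b by (intro antisym INF_lower INF_greatest)
  moreover have "minimizers n t x \<inter> cell s \<noteq> {} \<longleftrightarrow> (\<forall>a. objective n t x b \<le> objective n t x a)"
    using b by (auto simp: minimizers_def) (meson order_trans)
  ultimately show ?thesis by (simp add: le_INF_iff)
qed

lemma minimizers_nested_cells:
  fixes x :: "nat \<Rightarrow> 'a::metric_space"
  assumes balls: "\<forall>(c::'a) R. R > 0 \<longrightarrow> (\<exists>T. compact_ball_topology c R T)" and "2 * t < n"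
    and ne: "\<And>k. minimizers n t x \<inter> cell (map c [0..<k]) \<noteq> {}"
  shows "minimizers n t x \<inter> (\<Inter>k. cball (c k) ((1/2) ^ k)) \<noteq> {}"
proof -
  obtain T where T: "compact_ball_topology (c 0) 1 T" using balls[rule_format, of 1] by auto
  define K where "K k = minimizers n t x \<inter> cell (map c [0..<Suc k])" for k
  have cell_eq: "cell (map c [0..<k]) = (\<Inter>i<k. cball (c i) ((1/2) ^ i))" for k
    by (auto simp: cell_def)
  have "closedin T (K k)" for k
  proof -
    have "K k = (cball (c 0) 1 \<inter> minimizers n t x) \<inter> cell (map c [0..<Suc k])"
      by (auto simp: K_def cell_eq simp del: upt_Suc)
    moreover have "closedin T (cell (map c [0..<Suc k]))"
      by (rule closedin_cell) (use T in \<open>simp_all del: upt_Suc\<close>)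
    ultimately show ?thesis using closedin_minimizers[OF T assms(2)] by auto
  qed
  moreover have "K k \<noteq> {}" for k unfolding K_def by (rule ne)
  moreover have "decseq K" by (auto simp: decseq_def K_def cell_eq simp del: upt_Suc)
  ultimately have "(\<Inter>k. K k) \<noteq> {}"
    using T by (intro compact_space_imp_nest[of T]) (auto simp: compact_ball_topology_def)
  then show ?thesis by (fastforce simp: K_def cell_eq simp del: upt_Suc)
qed

theorem proposition3p1:
  fixes n t :: nat
  assumes "favorable TYPE('a::{metric_space, second_countable_topology})"
    and "n > 0" and "2 * t < n"
  shows "\<exists>\<mu> :: (nat \<Rightarrow> 'a) \<Rightarrow> 'a.
    \<mu> \<in> measurable (\<Pi>\<^sub>M i\<in>{..<n}. (borel :: 'a measure)) (borel :: 'a measure) \<and>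
    (\<forall>x \<in> {..<n} \<rightarrow>\<^sub>E (UNIV :: 'a set).
       is_arg_min
         (\<lambda>b. SUP a. ereal (trimmed_mean n t (\<lambda>z. (dist b z)\<^sup>2 - (dist a z)\<^sup>2) x))
         (\<lambda>b. True) (\<mu> x))"
proof -
  let ?M = "\<Pi>\<^sub>M i\<in>{..<n}. (borel :: 'a measure)"
  have balls: "\<forall>(c::'a) R. R > 0 \<longrightarrow> (\<exists>T. compact_ball_topology c R T)"
    using assms(1) unfolding favorable_def compact_ball_topology_def by blast
  have "\<exists>\<mu> \<in> borel_measurable ?M. \<forall>x \<in> space ?M. \<mu> x \<in> minimizers n t x"
  proof (rule measurable_selection_cells)
    fix x assume "x \<in> space ?M"
    show "minimizers n t x \<noteq> {}" by (rule minimizers_nonempty[OF balls assms(3)])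
  next
    fix s :: "'a list"
    show "{x \<in> space ?M. minimizers n t x \<inter> cell s \<noteq> {}} \<in> sets ?M"
    proof (cases "cell s = {}")
      case False
      have [measurable]: "(\<lambda>x. INF b\<in>cell s. objective n t x b) \<in> borel_measurable ?M"
        "(\<lambda>x. INF b. objective n t x b) \<in> borel_measurable ?M"
        by (rule measurable_INF_objective[OF assms(3)])+
      have "{x \<in> space ?M. (INF b\<in>cell s. objective n t x b) \<le> (INF b. objective n t x b)} \<in> sets ?M"
        by (rule borel_measurable_le) measurable
      then show ?thesis by (simp add: minimizers_meet_cell_iff[OF balls assms(3) False])
    qed simp
  next
    fix x and c :: "nat \<Rightarrow> 'a"
    assume "\<And>k. minimizers n t x \<inter> cell (map c [0..<k]) \<noteq> {}"
    then show "minimizers n t x \<inter> (\<Inter>k. cball (c k) ((1/2) ^ k)) \<noteq> {}"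
      by (rule minimizers_nested_cells[OF balls assms(3)])
  qed
  then obtain \<mu> where \<mu>: "\<mu> \<in> borel_measurable ?M" "\<And>x. x \<in> space ?M \<Longrightarrow> \<mu> x \<in> minimizers n t x"
    by blast
  have "is_arg_min (objective n t x) (\<lambda>b. True) (\<mu> x)" if "x \<in> {..<n} \<rightarrow>\<^sub>E (UNIV :: 'a set)" for x
    using \<mu>(2)[of x] that by (simp add: space_PiM is_arg_min_def minimizers_def not_less)
  then show ?thesis using \<mu>(1) unfolding objective_def by blast
qed

end
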